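(* Let $A=[a_{x,y}]_{x,y\in\mathbb Z}$ be a doubly infinite hermitian matrix with complex entries, i.e. $a_{x,y}^*=a_{y,x}$ for all $x,y\in\mathbb Z$. Suppose that $A$ is an $(nJ)$-matrix for some integer $n\ge 1$, i.e. $$a_{x,y}=0\quad\text{for all } x,y\in\mathbb Z \text{ with } |x-y|>n,$$ and that $$\lim_{|x|\to+\infty}\frac{1}{\langle x\rangle}\left(\sum_{y\in\mathbb Z}|a_{x,y}|\right)=0.$$ Then the operator $A:c_0(\mathbb Z)\to\ell_2(\mathbb Z)$ given by $(Af)_x:=\sum_{y\in\mathbb Z}a_{x,y}f_y$, $x\in\mathbb Z$, $f\in c_0(\mathbb Z)$, is essentially self-adjoint on $\ell_2(\mathbb Z)$.
   Context: Here $a^*$ denotes the complex conjugate of $a\in\mathbb C$, and $\langle a\rangle:=(1+|a|^2)^{1/2}$. The space $\ell_2(\mathbb Z)$ is the complex Hilbert space of doubly infinite complex sequences $f=(f_x)_{x\in\mathbb Z}$ with $\|f\|_{\ell_2(\mathbb Z)}=\left(\sum_x|f_x|^2\right)^{1/2}<+\infty$, and $c_0(\mathbb Z)\subset\ell_2(\mathbb Z)$ denotes the subspace of compactly (finitely) supported sequences. The operator $A$ with domain $c_0(\mathbb Z)$ is symmetric and closable; essentially self-adjoint means that its closure $\bar A:D(\bar A)\to\ell_2(\mathbb Z)$ is self-adjoint. *)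

theory Defs
  imports "HOL-Analysis.Analysis"
begin

text \<open>
  The space \<open>\<ell>\<^sub>2(\<int>)\<close> is rendered as a set of functions \<open>int \<Rightarrow> complex\<close> with explicit norm and inner
  product. An (unbounded) operator in it is identified with its graph, a set of pairs \<open>(f, Tf)\<close>, so
  that \<open>Domain T\<close> is its domain and equality of operators includes equality of domains.
\<close>

definition ell2 :: "(int \<Rightarrow> complex) set" where
  "ell2 = {f. (\<lambda>x. (cmod (f x))\<^sup>2) summable_on UNIV}"

definition ell2_norm :: "(int \<Rightarrow> complex) \<Rightarrow> real" where
  "ell2_norm f = sqrt (\<Sum>\<^sub>\<infinity>x. (cmod (f x))\<^sup>2)"

definition ell2_inner :: "(int \<Rightarrow> complex) \<Rightarrow> (int \<Rightarrow> complex) \<Rightarrow> complex" where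
  "ell2_inner f g = (\<Sum>\<^sub>\<infinity>x. f x * cnj (g x))"

definition ell2_tendsto :: "(nat \<Rightarrow> int \<Rightarrow> complex) \<Rightarrow> (int \<Rightarrow> complex) \<Rightarrow> bool" where
  "ell2_tendsto u f \<longleftrightarrow> (\<lambda>k. ell2_norm (\<lambda>x. u k x - f x)) \<longlonglongrightarrow> 0"

definition c0 :: "(int \<Rightarrow> complex) set" where
  "c0 = {f. finite {x. f x \<noteq> 0}}"

type_synonym ell2_operator = "((int \<Rightarrow> complex) \<times> (int \<Rightarrow> complex)) set"

definition linear_operator :: "ell2_operator \<Rightarrow> bool" where
  "linear_operator T \<longleftrightarrow>
     T \<subseteq> ell2 \<times> ell2 \<and> single_valued T \<and>
     ((\<lambda>x. 0), (\<lambda>x. 0)) \<in> T \<and>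
     (\<forall>f g f' g'. (f, g) \<in> T \<longrightarrow> (f', g') \<in> T \<longrightarrow> ((\<lambda>x. f x + f' x), (\<lambda>x. g x + g' x)) \<in> T) \<and>
     (\<forall>c f g. (f, g) \<in> T \<longrightarrow> ((\<lambda>x. c * f x), (\<lambda>x. c * g x)) \<in> T)"

definition densely_defined :: "ell2_operator \<Rightarrow> bool" where
  "densely_defined T \<longleftrightarrow> (\<forall>f\<in>ell2. \<exists>u. (\<forall>k. u k \<in> Domain T) \<and> ell2_tendsto u f)"

text \<open>The closure of the graph; it is the graph of an operator iff \<open>T\<close> is closable.\<close>

definition op_closure :: "ell2_operator \<Rightarrow> ell2_operator" where
  "op_closure T = {(f, g) \<in> ell2 \<times> ell2.
     \<exists>u v. (\<forall>k. (u k, v k) \<in> T) \<and> ell2_tendsto u f \<and> ell2_tendsto v g}"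

definition op_adjoint :: "ell2_operator \<Rightarrow> ell2_operator" where
  "op_adjoint T = {(g, h) \<in> ell2 \<times> ell2. \<forall>(f, Tf)\<in>T. ell2_inner Tf g = ell2_inner f h}"

definition symmetric_operator :: "ell2_operator \<Rightarrow> bool" where
  "symmetric_operator T \<longleftrightarrow> linear_operator T \<and> densely_defined T \<and>
     (\<forall>(f, Tf)\<in>T. \<forall>(g, Tg)\<in>T. ell2_inner Tf g = ell2_inner f Tg)"

definition self_adjoint_operator :: "ell2_operator \<Rightarrow> bool" where
  "self_adjoint_operator T \<longleftrightarrow> linear_operator T \<and> densely_defined T \<and> op_adjoint T = T"

text \<open>Closability is included: a self-adjoint \<open>op_closure T\<close> is in particular single-valued.\<close>

definition essentially_self_adjoint :: "ell2_operator \<Rightarrow> bool" where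
  "essentially_self_adjoint T \<longleftrightarrow> symmetric_operator T \<and> self_adjoint_operator (op_closure T)"

definition japanese_bracket :: "complex \<Rightarrow> real" where
  "japanese_bracket a = sqrt (1 + (cmod a)\<^sup>2)"

definition hermitian_matrix :: "(int \<Rightarrow> int \<Rightarrow> complex) \<Rightarrow> bool" where
  "hermitian_matrix a \<longleftrightarrow> (\<forall>x y. cnj (a x y) = a y x)"

definition nJ_matrix :: "nat \<Rightarrow> (int \<Rightarrow> int \<Rightarrow> complex) \<Rightarrow> bool" where
  "nJ_matrix n a \<longleftrightarrow> (\<forall>x y. \<bar>x - y\<bar> > int n \<longrightarrow> a x y = 0)"

definition matrix_operator :: "(int \<Rightarrow> int \<Rightarrow> complex) \<Rightarrow> ell2_operator" where
  "matrix_operator a = {(f, \<lambda>x. \<Sum>\<^sub>\<infinity>y. a x y * f y) | f. f \<in> c0}"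

end

theory Submission imports Defs begin

text \<open>
  Testing against unit vectors shows that the adjoint of the matrix operator is the maximal operator
  \<open>g \<mapsto> Ag\<close> on \<open>{g \<in> \<ell>\<^sub>2. Ag \<in> \<ell>\<^sub>2}\<close>. For such \<open>g\<close> and a cutoff \<open>\<chi>\<close> at scale \<open>R\<close>, the commutator
  \<open>(A\<chi> - \<chi>A)g\<close> has matrix entries \<open>a x y * (\<chi> y - \<chi> x)\<close>, which are bounded uniformly in \<open>R\<close>: the
  slope \<open>1/R\<close> of \<open>\<chi>\<close> compensates the linear growth of \<open>a\<close>. As \<open>a\<close> is banded, the commutator is thus
  dominated by a finite sum of shifts of \<open>\<bar>g\<bar>\<close>, and it vanishes pointwise as \<open>R \<rightarrow> \<infinity>\<close>, so
  \<open>A(\<chi>g) \<rightarrow> Ag\<close> in \<open>\<ell>\<^sub>2\<close> by dominated convergence. Hence the maximal operator is the closure, and the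
  same approximation shows that it is symmetric, hence self-adjoint.
\<close>

section \<open>Square-summable sequences\<close>

text \<open>Absolutely convergent sums over a type are integrals for the counting measure, so
  Lebesgue's dominated convergence theorem applies.\<close>

lemma infsum_dominated_convergence:
  fixes s :: "nat \<Rightarrow> 'a \<Rightarrow> 'b :: {banach, second_countable_topology}"
  assumes w: "w summable_on UNIV"
    and bound: "\<And>k x. norm (s k x) \<le> w x"
    and lim: "\<And>x. (\<lambda>k. s k x) \<longlonglongrightarrow> f x"
  shows "(\<lambda>k. \<Sum>\<^sub>\<infinity>x. s k x) \<longlonglongrightarrow> (\<Sum>\<^sub>\<infinity>x. f x)"
proof -
  have bound_f: "norm (f x) \<le> w x" for x
    by (rule Lim_bounded[OF tendsto_norm[OF lim]]) (auto intro: bound)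
  \<comment> \<open>Stated for any \<open>g\<close> dominated by \<open>w\<close>, as it serves both
    for the terms \<open>s k\<close> and for the limit \<open>f\<close>.\<close>
  have eq: "infsum g UNIV = integral\<^sup>L (count_space UNIV) g"
    if "\<And>x. norm (g x) \<le> w x" for g :: "'a \<Rightarrow> 'b"
  proof -
    have "Infinite_Sum.abs_summable_on g UNIV"
      by (rule Infinite_Sum.abs_summable_on_comparison_test'[OF w that])
    then have "Infinite_Set_Sum.abs_summable_on g UNIV"
      by (simp add: abs_summable_equivalent)
    then show ?thesis
      by (simp add: infsetsum_infsum[symmetric] infsetsum_def)
  qed
  have "w x \<ge> 0" for x
    using bound[of 0 x] norm_ge_zero order_trans by blast
  then have "Infinite_Set_Sum.abs_summable_on w UNIV"
    using w by (simp flip: abs_summable_equivalent)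
  then have "integrable (count_space UNIV) w"
    by (simp add: Infinite_Set_Sum.abs_summable_on_def)
  then have "(\<lambda>k. integral\<^sup>L (count_space UNIV) (s k)) \<longlonglongrightarrow> integral\<^sup>L (count_space UNIV) f"
    by (intro integral_dominated_convergence[where w = w]) (auto simp: bound lim)
  then show ?thesis
    by (simp add: eq bound bound_f)
qed

lemma infsum_finite_sum:
  fixes F :: "'i \<Rightarrow> 'a \<Rightarrow> 'b :: {topological_comm_monoid_add, t2_space}"
  assumes "finite I" "\<And>i. i \<in> I \<Longrightarrow> F i summable_on S"
  shows "(\<Sum>\<^sub>\<infinity>x\<in>S. \<Sum>i\<in>I. F i x) = (\<Sum>i\<in>I. \<Sum>\<^sub>\<infinity>x\<in>S. F i x)"
proof -
  have "((\<lambda>x. \<Sum>i\<in>I. F i x) has_sum (\<Sum>i\<in>I. \<Sum>\<^sub>\<infinity>x\<in>S. F i x)) S"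
    using assms by (induction I rule: finite_induct) (auto intro: has_sum_add has_sum_infsum)
  then show ?thesis by (rule infsumI)
qed

lemma ell2_comparison:
  assumes "g \<in> ell2" "\<And>x. cmod (f x) \<le> cmod (g x)"
  shows "f \<in> ell2"
proof -
  have "(\<lambda>x. norm ((cmod (f x))\<^sup>2)) summable_on UNIV"
    using assms(1) unfolding ell2_def
    by (intro Infinite_Sum.abs_summable_on_comparison_test') (auto intro!: power_mono assms(2))
  then show ?thesis by (simp add: ell2_def)
qed

text \<open>The elementary bound (p + q)^2 \<le> 2 (p^2 + q^2) supplies a summable majorant.\<close>

lemma ell2_add:
  assumes "f \<in> ell2" "g \<in> ell2"
  shows "(\<lambda>x. f x + g x) \<in> ell2"
proof -
  have "(cmod (f x + g x))\<^sup>2 \<le> 2 * ((cmod (f x))\<^sup>2 + (cmod (g x))\<^sup>2)" for x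
  proof -
    have "(cmod (f x + g x))\<^sup>2 \<le> (cmod (f x) + cmod (g x))\<^sup>2"
      by (intro power_mono norm_triangle_ineq) auto
    also have "\<dots> \<le> 2 * ((cmod (f x))\<^sup>2 + (cmod (g x))\<^sup>2)"
      using sum_squares_bound[of "cmod (f x)" "cmod (g x)"] by (simp add: power2_sum)
    finally show ?thesis .
  qed
  moreover have "(\<lambda>x. 2 * ((cmod (f x))\<^sup>2 + (cmod (g x))\<^sup>2)) summable_on UNIV"
    using assms unfolding ell2_def by (intro summable_on_cmult_right summable_on_add) auto
  ultimately have "(\<lambda>x. norm ((cmod (f x + g x))\<^sup>2)) summable_on UNIV"
    by (intro Infinite_Sum.abs_summable_on_comparison_test') auto
  then show ?thesis by (simp add: ell2_def)
qed

lemma ell2_cmult: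
  assumes "f \<in> ell2"
  shows "(\<lambda>x. c * f x) \<in> ell2"
  using assms unfolding ell2_def by (auto simp: norm_mult power_mult_distrib intro: summable_on_cmult_right)

lemma ell2_zero: "(\<lambda>x. 0) \<in> ell2"
  by (simp add: ell2_def)

lemma ell2_diff:
  assumes "f \<in> ell2" "g \<in> ell2"
  shows "(\<lambda>x. f x - g x) \<in> ell2"
  using ell2_add[OF assms(1) ell2_cmult[OF assms(2), of "-1"]] by simp

text \<open>Allows majorants built from absolute values to be treated by the closure properties of
  \<open>ell2\<close>.\<close>

lemma ell2_cmod: "(\<lambda>x. of_real (cmod (f x))) \<in> ell2 \<longleftrightarrow> f \<in> ell2"
  by (simp add: ell2_def)

lemma ell2_shift:
  assumes "f \<in> ell2"
  shows "(\<lambda>x. f (x + j)) \<in> ell2"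
proof -
  have "bij (\<lambda>x. x + j)"
    by (rule bij_betw_byWitness[where f' = "\<lambda>x. x - j"]) auto
  from summable_on_reindex_bij_betw[OF this, of "\<lambda>x. (cmod (f x))\<^sup>2"] show ?thesis
    using assms by (simp add: ell2_def)
qed

lemma ell2_sum:
  assumes "finite J" "\<And>j. j \<in> J \<Longrightarrow> f j \<in> ell2"
  shows "(\<lambda>x. \<Sum>j\<in>J. f j x) \<in> ell2"
  using assms by (induction J rule: finite_induct) (auto intro: ell2_zero ell2_add)

lemma c0_add: "f \<in> c0 \<Longrightarrow> g \<in> c0 \<Longrightarrow> (\<lambda>x. f x + g x) \<in> c0"
  unfolding c0_def by (auto intro: rev_finite_subset[where B = "{x. f x \<noteq> 0} \<union> {x. g x \<noteq> 0}"])

lemma c0_subset_ell2: "c0 \<subseteq> ell2"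
proof
  fix f assume "f \<in> c0"
  then have "finite {x. (cmod (f x))\<^sup>2 \<noteq> 0}" by (simp add: c0_def)
  then show "f \<in> ell2"
    using finite_nonzero_values_imp_summable_on[of UNIV "\<lambda>x. (cmod (f x))\<^sup>2"] by (simp add: ell2_def)
qed

section \<open>Coordinatewise limits and dominated convergence in \<open>ell2\<close>\<close>

lemma cmod_le_ell2_norm:
  assumes "f \<in> ell2"
  shows "cmod (f x) \<le> ell2_norm f"
proof -
  have "(\<Sum>y\<in>{x}. (cmod (f y))\<^sup>2) \<le> (\<Sum>\<^sub>\<infinity>y. (cmod (f y))\<^sup>2)"
    using assms by (intro finite_sum_le_infsum) (auto simp: ell2_def)
  then show ?thesis unfolding ell2_norm_def by (simp add: real_le_rsqrt)
qed

lemma ell2_tendsto_imp_tendsto: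
  assumes "ell2_tendsto u f" "\<And>k. u k \<in> ell2" "f \<in> ell2"
  shows "(\<lambda>k. u k x) \<longlonglongrightarrow> f x"
proof -
  have "(\<lambda>k. u k x - f x) \<longlonglongrightarrow> 0"
    using assms(1) unfolding ell2_tendsto_def
    by (rule Lim_null_comparison[rotated])
      (intro always_eventually allI cmod_le_ell2_norm[of "\<lambda>x. u _ x - f x"] ell2_diff assms)
  then show ?thesis by (simp add: LIM_zero_iff)
qed

text \<open>Dominated convergence for the squared distances, with majorant \<bar>D\<bar>^2. The
  majorant is itself a sequence, so that its square-summability reads
  \<open>D \<in> ell2\<close>.\<close>

lemma ell2_tendsto_dominated:
  assumes D: "D \<in> ell2"
    and bound: "\<And>k x. cmod (u k x - f x) \<le> cmod (D x)"
    and lim: "\<And>x. (\<lambda>k. u k x) \<longlonglongrightarrow> f x"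
  shows "ell2_tendsto u f"
proof -
  have "(\<lambda>k. (cmod (u k x - f x))\<^sup>2) \<longlonglongrightarrow> 0" for x
    using tendsto_power[OF tendsto_norm[OF LIM_zero[OF lim[of x]]], of 2] by simp
  then have "(\<lambda>k. \<Sum>\<^sub>\<infinity>x. (cmod (u k x - f x))\<^sup>2) \<longlonglongrightarrow> (\<Sum>\<^sub>\<infinity>x::int. 0)"
    using D unfolding ell2_def
    by (intro infsum_dominated_convergence[where w = "\<lambda>x. (cmod (D x))\<^sup>2"])
      (auto intro!: power_mono bound)
  from tendsto_real_sqrt[OF this] show ?thesis
    by (simp add: ell2_tendsto_def ell2_norm_def)
qed

text \<open>The products are dominated by \<bar>D\<bar>^2 + \<bar>g\<bar>^2, so pointwise
  convergence of \<open>u k\<close> suffices to pass to the limit in the inner product.\<close>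

lemma ell2_inner_dominated:
  assumes D: "D \<in> ell2" and g: "g \<in> ell2"
    and bound: "\<And>k x. cmod (u k x) \<le> cmod (D x)"
    and lim: "\<And>x. (\<lambda>k. u k x) \<longlonglongrightarrow> f x"
  shows "(\<lambda>k. ell2_inner (u k) g) \<longlonglongrightarrow> ell2_inner f g"
  unfolding ell2_inner_def
proof (rule infsum_dominated_convergence)
  show "(\<lambda>x. (cmod (D x))\<^sup>2 + (cmod (g x))\<^sup>2) summable_on UNIV"
    using D g unfolding ell2_def by (intro summable_on_add) auto
  fix k x
  have "norm (u k x * cnj (g x)) \<le> cmod (D x) * cmod (g x)"
    by (simp add: norm_mult mult_right_mono bound)
  also have "\<dots> \<le> 2 * cmod (D x) * cmod (g x)" by simp
  also have "\<dots> \<le> (cmod (D x))\<^sup>2 + (cmod (g x))\<^sup>2"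
    by (rule sum_squares_bound)
  finally show "norm (u k x * cnj (g x)) \<le> (cmod (D x))\<^sup>2 + (cmod (g x))\<^sup>2" .
qed (intro tendsto_intros lim)

section \<open>Cutoff functions\<close>

text \<open>The trapezoidal cutoff at scale R = \<open>Suc k\<close>: equal to 1 for \<bar>x\<bar>
  \<le> R, linear in \<bar>x\<bar> between R and 2R, and 0 beyond. The successor keeps R
  positive.\<close>

definition cutoff :: "nat \<Rightarrow> int \<Rightarrow> real" where
  "cutoff k x = max 0 (min 1 (2 - \<bar>real_of_int x\<bar> / real (Suc k)))"

lemma cutoff_nonneg: "0 \<le> cutoff k x" and cutoff_le_1: "cutoff k x \<le> 1"
  by (auto simp: cutoff_def)

lemma cutoff_eq_1: "\<bar>x\<bar> \<le> int k \<Longrightarrow> cutoff k x = 1"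
  by (auto simp: cutoff_def field_simps min_def)

lemma cutoff_eq_0: "\<bar>x\<bar> \<ge> 2 * int (Suc k) \<Longrightarrow> cutoff k x = 0"
proof -
  assume "\<bar>x\<bar> \<ge> 2 * int (Suc k)"
  then have "\<bar>real_of_int x\<bar> \<ge> 2 * real (Suc k)" by linarith
  then have "\<bar>real_of_int x\<bar> / real (Suc k) \<ge> 2" by (simp add: field_simps)
  then show ?thesis by (simp add: cutoff_def)
qed

lemma eventually_cutoff_eq_1: "eventually (\<lambda>k. cutoff k x = 1) sequentially"
  using eventually_ge_at_top[of "nat \<bar>x\<bar>"]
  by eventually_elim (auto intro: cutoff_eq_1)

lemma cutoff_mult_c0: "(\<lambda>x. of_real (cutoff k x) * f x) \<in> c0"
proof -
  have "{x. of_real (cutoff k x) * f x \<noteq> 0} \<subseteq> {-2 * int (Suc k)..2 * int (Suc k)}"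
    using cutoff_eq_0[of k] by (force simp: not_le)
  then show ?thesis unfolding c0_def using finite_subset by blast
qed

lemma cutoff_mult_le: "cmod (of_real (cutoff k x) * f x) \<le> cmod (f x)"
  using cutoff_nonneg[of k x] cutoff_le_1[of k x]
  by (simp add: norm_mult mult_left_le_one_le)

lemma cutoff_mult_tendsto: "(\<lambda>k. of_real (cutoff k x) * f x) \<longlonglongrightarrow> f x"
  by (rule tendsto_eventually) (use eventually_cutoff_eq_1[of x] in eventually_elim, simp)

lemma cutoff_mult_diff_le: "cmod (of_real (cutoff k x) * f x - f x) \<le> cmod (f x)"
proof -
  have "of_real (cutoff k x) * f x - f x = - (of_real (1 - cutoff k x) * f x)"
    by (simp add: algebra_simps)
  then have "cmod (of_real (cutoff k x) * f x - f x) = \<bar>1 - cutoff k x\<bar> * cmod (f x)"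
    by (simp only: norm_minus_cancel norm_mult norm_of_real)
  then show ?thesis
    using cutoff_nonneg[of k x] cutoff_le_1[of k x]
    by (simp add: mult_left_le_one_le)
qed

lemma cutoff_mult_ell2_tendsto:
  assumes "f \<in> ell2"
  shows "ell2_tendsto (\<lambda>k x. of_real (cutoff k x) * f x) f"
  by (rule ell2_tendsto_dominated[where D = f]) (fact assms cutoff_mult_diff_le cutoff_mult_tendsto)+

text \<open>The truncations of a square-summable sequence by the cutoffs have finite support and
  converge to it.\<close>

lemma densely_defined_if_c0:
  assumes "c0 \<subseteq> Domain T"
  shows "densely_defined T"
  unfolding densely_defined_def
proof (intro ballI exI conjI allI)
  fix f k assume f: "f \<in> ell2"
  show "ell2_tendsto (\<lambda>k x. of_real (cutoff k x) * f x) f"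
    by (rule cutoff_mult_ell2_tendsto[OF f])
  show "(\<lambda>x. of_real (cutoff k x) * f x) \<in> Domain T"
    using assms cutoff_mult_c0 by blast
qed

lemma cutoff_lipschitz: "\<bar>cutoff k y - cutoff k x\<bar> \<le> \<bar>real_of_int y - real_of_int x\<bar> / real (Suc k)"
proof -
  have "\<bar>\<bar>real_of_int y\<bar> / real (Suc k) - \<bar>real_of_int x\<bar> / real (Suc k)\<bar> \<le> \<bar>real_of_int y - real_of_int x\<bar> / real (Suc k)"
    by (simp add: abs_triangle_ineq3 divide_right_mono flip: diff_divide_distrib)
  \<comment> \<open>Clamping to the unit interval is 1-Lipschitz, so the slope is that of
    \<bar>x\<bar> / R.\<close>
  moreover have "\<bar>max 0 (min 1 (2 - p)) - max 0 (min 1 (2 - q))\<bar> \<le> \<bar>p - q\<bar>" for p q :: real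
    by (simp add: max_def min_def abs_minus_commute)
  ultimately show ?thesis unfolding cutoff_def using order_trans by blast
qed

text \<open>The cutoff at scale \<open>R\<close> has slope \<open>1/R\<close> and varies only where \<open>\<bar>x\<bar> = O(R)\<close>, hence its variation
  absorbs a linear factor uniformly in the scale.\<close>

lemma cutoff_variation:
  assumes "\<bar>x - y\<bar> \<le> int n"
  shows "\<bar>cutoff k y - cutoff k x\<bar> * (1 + \<bar>real_of_int x\<bar>) \<le> real (n * (n + 3))"
proof (cases "\<bar>x\<bar> \<le> 2 * int (Suc k) + int n")
  case True
  then have x: "1 + \<bar>real_of_int x\<bar> \<le> 1 + 2 * real (Suc k) + real n" by linarith
  have "\<bar>cutoff k y - cutoff k x\<bar> \<le> \<bar>real_of_int y - real_of_int x\<bar> / real (Suc k)"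
    by (rule cutoff_lipschitz)
  also have "\<dots> \<le> real n / real (Suc k)"
    using assms by (intro divide_right_mono) linarith+
  finally have "\<bar>cutoff k y - cutoff k x\<bar> * (1 + \<bar>real_of_int x\<bar>)
      \<le> real n / real (Suc k) * (1 + 2 * real (Suc k) + real n)"
    using x by (intro mult_mono) auto
  \<comment> \<open>With R = \<open>Suc k\<close> \<ge> 1, both 1 \<le> R and n \<le> nR hold, hence
    1 + 2R + n \<le> R (n + 3); the factor R then cancels.\<close>
  also have "\<dots> \<le> real n / real (Suc k) * (real (Suc k) * (real n + 3))"
  proof (intro mult_left_mono)
    have "real n * 1 \<le> real n * real (Suc k)" by (intro mult_left_mono) auto
    then show "1 + 2 * real (Suc k) + real n \<le> real (Suc k) * (real n + 3)"
      by (simp add: algebra_simps)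
  qed auto
  also have "\<dots> = real (n * (n + 3))" by (simp del: of_nat_Suc)
  finally show ?thesis .
next
  case False
  \<comment> \<open>Since y is within n of x, both points lie where the cutoff is 0, and the
    variation vanishes.\<close>
  then have "\<bar>x\<bar> \<ge> 2 * int (Suc k)" "\<bar>y\<bar> \<ge> 2 * int (Suc k)" using assms by linarith+
  then show ?thesis by (simp add: cutoff_eq_0)
qed

section \<open>Hermitian band matrices\<close>

text \<open>Defined on all sequences, since the maximal operator acts outside \<open>c0\<close>; for
  a band matrix every row sum is finite.\<close>

definition matrix_apply :: "(int \<Rightarrow> int \<Rightarrow> complex) \<Rightarrow> (int \<Rightarrow> complex) \<Rightarrow> int \<Rightarrow> complex" where
  "matrix_apply a f x = (\<Sum>\<^sub>\<infinity>y. a x y * f y)"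

definition maximal_operator :: "(int \<Rightarrow> int \<Rightarrow> complex) \<Rightarrow> ell2_operator" where
  "maximal_operator a = {(f, matrix_apply a f) | f. f \<in> ell2 \<and> matrix_apply a f \<in> ell2}"

lemma matrix_operator_eq: "matrix_operator a = {(f, matrix_apply a f) | f. f \<in> c0}"
  by (simp add: matrix_operator_def matrix_apply_def[abs_def])

context
  fixes a :: "int \<Rightarrow> int \<Rightarrow> complex" and n :: nat
  assumes hermitian: "hermitian_matrix a" and band: "nJ_matrix n a"
begin

lemma cnj_entry: "cnj (a x y) = a y x"
  using hermitian by (simp add: hermitian_matrix_def)

lemma entry_eq_0: "y \<notin> {x - int n..x + int n} \<Longrightarrow> a x y = 0"
  using band by (auto simp: nJ_matrix_def)

text \<open>The hypothesis ties \<open>F\<close> to the zeros of row \<open>x\<close>, so that it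
  covers both the terms \<open>a x y * f y\<close> and the absolute values
  \<open>cmod (a x y)\<close>.\<close>

lemma infsum_row:
  assumes "\<And>y. a x y = 0 \<Longrightarrow> F y = 0"
  shows "(\<Sum>\<^sub>\<infinity>y. F y) = (\<Sum>y\<in>{x - int n..x + int n}. F y)"
proof -
  have "(\<Sum>\<^sub>\<infinity>y. F y) = (\<Sum>\<^sub>\<infinity>y\<in>{x - int n..x + int n}. F y)"
    by (rule infsum_cong_neutral) (use assms entry_eq_0 in auto)
  then show ?thesis by simp
qed

lemma matrix_apply_eq_sum: "matrix_apply a f x = (\<Sum>y\<in>{x - int n..x + int n}. a x y * f y)"
  unfolding matrix_apply_def by (rule infsum_row) simp

lemma cnj_matrix_apply: "cnj (matrix_apply a f x) = (\<Sum>\<^sub>\<infinity>y. a y x * cnj (f y))"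
  by (simp add: matrix_apply_def cnj_entry flip: infsum_cnj)

lemma matrix_apply_add: "matrix_apply a (\<lambda>x. f x + g x) = (\<lambda>x. matrix_apply a f x + matrix_apply a g x)"
  by (simp add: matrix_apply_eq_sum fun_eq_iff algebra_simps sum.distrib)

lemma matrix_apply_cmult: "matrix_apply a (\<lambda>x. c * f x) = (\<lambda>x. c * matrix_apply a f x)"
  by (simp add: matrix_apply_eq_sum fun_eq_iff algebra_simps sum_distrib_left)

lemma matrix_apply_zero: "matrix_apply a (\<lambda>x. 0) = (\<lambda>x. 0)"
  by (simp add: matrix_apply_eq_sum fun_eq_iff)

text \<open>Each coordinate of the image is a finite linear combination of coordinates of the
  argument.\<close>

lemma matrix_apply_tendsto:
  assumes "\<And>y. (\<lambda>k. u k y) \<longlonglongrightarrow> f y"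
  shows "(\<lambda>k. matrix_apply a (u k) x) \<longlonglongrightarrow> matrix_apply a f x"
  unfolding matrix_apply_eq_sum by (intro tendsto_intros assms)

text \<open>The band condition lets the support spread by at most \<open>n\<close> in each
  direction.\<close>

lemma matrix_apply_c0:
  assumes "f \<in> c0"
  shows "matrix_apply a f \<in> c0"
proof -
  have "{x. matrix_apply a f x \<noteq> 0} \<subseteq> (\<Union>y\<in>{y. f y \<noteq> 0}. {y - int n..y + int n})"
  proof
    fix x assume "x \<in> {x. matrix_apply a f x \<noteq> 0}"
    then obtain y where "y \<in> {x - int n..x + int n}" "a x y * f y \<noteq> 0"
      unfolding matrix_apply_eq_sum by (auto elim: sum.not_neutral_contains_not_neutral)
    then show "x \<in> (\<Union>y\<in>{y. f y \<noteq> 0}. {y - int n..y + int n})" by auto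
  qed
  moreover have "finite (\<Union>y\<in>{y. f y \<noteq> 0}. {y - int n..y + int n})"
    using assms by (auto simp: c0_def)
  ultimately show ?thesis unfolding c0_def using finite_subset by blast
qed

section \<open>The matrix operator, its adjoint and its closure\<close>

lemma linear_maximal_operator: "linear_operator (maximal_operator a)"
  unfolding linear_operator_def maximal_operator_def single_valued_def
  by (auto simp: matrix_apply_add matrix_apply_cmult matrix_apply_zero ell2_zero ell2_add ell2_cmult)

lemma linear_matrix_operator: "linear_operator (matrix_operator a)"
proof -
  have "(\<lambda>x. 0) \<in> c0" by (simp add: c0_def)
  moreover have "(\<lambda>x. c * f x) \<in> c0" if "f \<in> c0" for c f
    using that unfolding c0_def by (auto intro: rev_finite_subset)
  ultimately show ?thesis
    unfolding linear_operator_def matrix_operator_eq single_valued_def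
    using c0_subset_ell2 matrix_apply_c0
    by (auto simp: matrix_apply_add matrix_apply_cmult matrix_apply_zero c0_add)
qed

lemma matrix_operator_subset_maximal: "matrix_operator a \<subseteq> maximal_operator a"
  unfolding matrix_operator_eq maximal_operator_def using c0_subset_ell2 matrix_apply_c0 by auto

text \<open>The sum over y runs over the finite support of \<open>f\<close>, so the two sums can be
  exchanged; hermitian symmetry then turns columns into conjugated rows. As \<open>g\<close> is
  arbitrary, this also serves for elements of the maximal domain.\<close>

lemma ell2_inner_c0:
  assumes "f \<in> c0"
  shows "ell2_inner (matrix_apply a f) g = ell2_inner f (matrix_apply a g)"
proof -
  define F where "F = {y. f y \<noteq> 0}"
  have fin: "finite F" using assms by (simp add: F_def c0_def)
  have to_sum: "(\<Sum>\<^sub>\<infinity>y. G y) = (\<Sum>y\<in>F. G y)" if "\<And>y. f y = 0 \<Longrightarrow> G y = 0" for G :: "int \<Rightarrow> complex"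
  proof -
    have "(\<Sum>\<^sub>\<infinity>y. G y) = (\<Sum>\<^sub>\<infinity>y\<in>F. G y)"
      by (rule infsum_cong_neutral) (use that in \<open>auto simp: F_def\<close>)
    then show ?thesis using fin by simp
  qed
  \<comment> \<open>The band condition leaves only finitely many nonzero entries in column
    \<open>y\<close>.\<close>
  have summable: "(\<lambda>x. a x y * cnj (g x)) summable_on UNIV" for y
  proof (rule finite_nonzero_values_imp_summable_on)
    have "{x\<in>UNIV. a x y * cnj (g x) \<noteq> 0} \<subseteq> {y - int n..y + int n}"
    proof
      fix x assume "x \<in> {x\<in>UNIV. a x y * cnj (g x) \<noteq> 0}"
      then have "y \<in> {x - int n..x + int n}" using entry_eq_0[of y x] by auto
      then show "x \<in> {y - int n..y + int n}" by auto
    qed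
    then show "finite {x\<in>UNIV. a x y * cnj (g x) \<noteq> 0}" using finite_subset by blast
  qed
  have "ell2_inner (matrix_apply a f) g = (\<Sum>\<^sub>\<infinity>x. \<Sum>y\<in>F. f y * (a x y * cnj (g x)))"
    unfolding ell2_inner_def matrix_apply_def
    by (intro infsum_cong) (simp add: to_sum sum_distrib_left sum_distrib_right algebra_simps)
  also have "\<dots> = (\<Sum>y\<in>F. \<Sum>\<^sub>\<infinity>x. f y * (a x y * cnj (g x)))"
    by (intro infsum_finite_sum fin summable_on_cmult_right summable)
  also have "\<dots> = (\<Sum>y\<in>F. f y * cnj (matrix_apply a g y))"
    by (simp add: cnj_matrix_apply infsum_cmult_right')
  also have "\<dots> = ell2_inner f (matrix_apply a g)"
    unfolding ell2_inner_def by (simp add: to_sum)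
  finally show ?thesis .
qed

lemma symmetric_matrix_operator: "symmetric_operator (matrix_operator a)"
  unfolding symmetric_operator_def
proof (intro conjI linear_matrix_operator densely_defined_if_c0)
  show "c0 \<subseteq> Domain (matrix_operator a)" by (auto simp: matrix_operator_eq)
qed (auto simp: matrix_operator_eq ell2_inner_c0)

lemma op_adjoint_matrix_operator: "op_adjoint (matrix_operator a) = maximal_operator a"
proof
  show "maximal_operator a \<subseteq> op_adjoint (matrix_operator a)"
    by (auto simp: op_adjoint_def maximal_operator_def matrix_operator_eq ell2_inner_c0)
  show "op_adjoint (matrix_operator a) \<subseteq> maximal_operator a"
  proof clarify
    fix g h assume gh: "(g, h) \<in> op_adjoint (matrix_operator a)"
    have "h z = matrix_apply a g z" for z
    proof -
      \<comment> \<open>Pairing with the unit vector at \<open>z\<close> reads off the conjugate of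
        the coordinate at \<open>z\<close>.\<close>
      define d :: "int \<Rightarrow> complex" where "d = (\<lambda>y. if y = z then 1 else 0)"
      have d: "d \<in> c0" by (simp add: c0_def d_def)
      have inner_d: "ell2_inner d v = cnj (v z)" for v
      proof -
        have "ell2_inner d v = (\<Sum>\<^sub>\<infinity>x\<in>{z}. d x * cnj (v x))"
          unfolding ell2_inner_def by (rule infsum_cong_neutral) (auto simp: d_def)
        then show ?thesis by (simp add: d_def)
      qed
      have "ell2_inner d h = ell2_inner (matrix_apply a d) g"
        using gh d by (auto simp: op_adjoint_def matrix_operator_eq)
      also have "\<dots> = ell2_inner d (matrix_apply a g)" by (rule ell2_inner_c0[OF d])
      finally show ?thesis by (simp add: inner_d)
    qed
    then have "h = matrix_apply a g" by auto
    then show "(g, h) \<in> maximal_operator a"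
      using gh by (auto simp: op_adjoint_def maximal_operator_def)
  qed
qed

text \<open>Norm convergence implies coordinatewise convergence, which the finite row sums preserve;
  the limit of the images is thus the image of the limit.\<close>

lemma op_closure_subset_maximal: "op_closure (matrix_operator a) \<subseteq> maximal_operator a"
proof clarify
  fix f g assume "(f, g) \<in> op_closure (matrix_operator a)"
  then obtain u v where f: "f \<in> ell2" and g: "g \<in> ell2"
    and uv: "\<And>k. (u k, v k) \<in> matrix_operator a"
    and u: "ell2_tendsto u f" and v: "ell2_tendsto v g"
    by (auto simp: op_closure_def)
  have uc: "u k \<in> c0" and veq: "v k = matrix_apply a (u k)" for k
    using uv[of k] by (auto simp: matrix_operator_eq)
  have u2: "u k \<in> ell2" and v2: "v k \<in> ell2" for k
    using uc[of k] matrix_apply_c0 c0_subset_ell2 by (auto simp: veq)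
  have "g x = matrix_apply a f x" for x
  proof (rule LIMSEQ_unique)
    show "(\<lambda>k. v k x) \<longlonglongrightarrow> g x" by (rule ell2_tendsto_imp_tendsto[OF v v2 g])
    show "(\<lambda>k. v k x) \<longlonglongrightarrow> matrix_apply a f x"
      unfolding veq by (intro matrix_apply_tendsto ell2_tendsto_imp_tendsto[OF u u2 f])
  qed
  then have "g = matrix_apply a f" by auto
  then show "(f, g) \<in> maximal_operator a"
    using f g by (auto simp: maximal_operator_def)
qed

section \<open>Commutators with the cutoffs\<close>

text \<open>In each entry of the commutator the growth of \<open>a\<close> is paid for by
  \<open>cutoff_variation\<close>, which makes the bound independent of \<open>k\<close>.\<close>

lemma cutoff_commutator_bound:
  assumes C: "\<And>x y. cmod (a x y) \<le> C * (1 + \<bar>real_of_int x\<bar>)"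
  shows "cmod (matrix_apply a (\<lambda>y. of_real (cutoff k y) * f y) x - of_real (cutoff k x) * matrix_apply a f x)
    \<le> C * real (n * (n + 3)) * (\<Sum>j\<in>{-int n..int n}. cmod (f (x + j)))"
proof -
  have C0: "C \<ge> 0" using order_trans[OF norm_ge_zero C[of 0 0]] by simp
  have "cmod (matrix_apply a (\<lambda>y. of_real (cutoff k y) * f y) x - of_real (cutoff k x) * matrix_apply a f x)
      = cmod (\<Sum>y\<in>{x - int n..x + int n}. a x y * of_real (cutoff k y - cutoff k x) * f y)"
    by (simp add: matrix_apply_eq_sum sum_distrib_left algebra_simps flip: sum_subtractf)
  also have "\<dots> \<le> (\<Sum>y\<in>{x - int n..x + int n}. C * real (n * (n + 3)) * cmod (f y))"
  proof (rule sum_norm_le)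
    fix y assume y: "y \<in> {x - int n..x + int n}"
    have "cmod (a x y) * \<bar>cutoff k y - cutoff k x\<bar>
        \<le> C * (1 + \<bar>real_of_int x\<bar>) * \<bar>cutoff k y - cutoff k x\<bar>"
      by (intro mult_right_mono C) auto
    also have "\<dots> = C * (\<bar>cutoff k y - cutoff k x\<bar> * (1 + \<bar>real_of_int x\<bar>))" by simp
    also have "\<dots> \<le> C * real (n * (n + 3))"
      using y C0 by (intro mult_left_mono cutoff_variation) auto
    finally show "cmod (a x y * of_real (cutoff k y - cutoff k x) * f y) \<le> C * real (n * (n + 3)) * cmod (f y)"
      by (simp only: norm_mult norm_of_real) (intro mult_right_mono norm_ge_zero)
  qed
  also have "\<dots> = C * real (n * (n + 3)) * (\<Sum>y\<in>{x - int n..x + int n}. cmod (f y))"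
    by (simp add: sum_distrib_left)
  \<comment> \<open>Substituting y = x + j exhibits the bound as a sum of shifts of \<bar>f\<bar>
    over an index set independent of x.\<close>
  also have "(\<Sum>y\<in>{x - int n..x + int n}. cmod (f y)) = (\<Sum>j\<in>{-int n..int n}. cmod (f (x + j)))"
    by (rule sum.reindex_bij_witness[where i = "\<lambda>j. x + j" and j = "\<lambda>y. y - x"]) auto
  finally show ?thesis .
qed

text \<open>A single majorant for all scales: the bound on the images is used for symmetry of the
  maximal operator, the bound on the differences for the closure.\<close>

lemma cutoff_matrix_apply_dominated:
  assumes C: "\<And>x y. cmod (a x y) \<le> C * (1 + \<bar>real_of_int x\<bar>)"
    and f: "f \<in> ell2" "matrix_apply a f \<in> ell2"
  obtains D where "D \<in> ell2"
    "\<And>k x. cmod (matrix_apply a (\<lambda>y. of_real (cutoff k y) * f y) x) \<le> cmod (D x)"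
    "\<And>k x. cmod (matrix_apply a (\<lambda>y. of_real (cutoff k y) * f y) x - matrix_apply a f x) \<le> cmod (D x)"
proof
  have C0: "C \<ge> 0" using order_trans[OF norm_ge_zero C[of 0 0]] by simp
  define B where "B x = C * real (n * (n + 3)) * (\<Sum>j\<in>{-int n..int n}. cmod (f (x + j)))" for x
  \<comment> \<open>\<open>B\<close> controls the commutator; the second summand controls both
    \<chi>Af and \<chi>Af - Af.\<close>
  define D where "D x = complex_of_real (B x) + complex_of_real (cmod (matrix_apply a f x))" for x
  have B0: "B x \<ge> 0" for x unfolding B_def using C0 by (intro mult_nonneg_nonneg sum_nonneg) auto
  have Dx: "cmod (D x) = B x + cmod (matrix_apply a f x)" for x
    unfolding D_def using B0[of x] by (simp flip: of_real_add)
  have "(\<lambda>x. \<Sum>j\<in>{-int n..int n}. complex_of_real (cmod (f (x + j)))) \<in> ell2"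
    by (intro ell2_sum ell2_shift[of "\<lambda>x. complex_of_real (cmod (f x))"]) (auto simp: ell2_cmod f)
  from ell2_cmult[OF this, of "of_real (C * real (n * (n + 3)))"]
  have "(\<lambda>x. complex_of_real (B x)) \<in> ell2" by (simp add: B_def)
  then show "D \<in> ell2" unfolding D_def using f by (intro ell2_add) (auto simp: ell2_cmod)
  fix k x
  have b: "cmod (matrix_apply a (\<lambda>y. of_real (cutoff k y) * f y) x - of_real (cutoff k x) * matrix_apply a f x) \<le> B x"
    unfolding B_def by (rule cutoff_commutator_bound[OF C])
  show "cmod (matrix_apply a (\<lambda>y. of_real (cutoff k y) * f y) x) \<le> cmod (D x)"
    unfolding Dx using norm_triangle_sub[of "matrix_apply a (\<lambda>y. of_real (cutoff k y) * f y) x" "of_real (cutoff k x) * matrix_apply a f x"]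
      b cutoff_mult_le[of k x "matrix_apply a f"] by linarith
  show "cmod (matrix_apply a (\<lambda>y. of_real (cutoff k y) * f y) x - matrix_apply a f x) \<le> cmod (D x)"
    unfolding Dx using norm_triangle_ineq[of "matrix_apply a (\<lambda>y. of_real (cutoff k y) * f y) x - of_real (cutoff k x) * matrix_apply a f x" "of_real (cutoff k x) * matrix_apply a f x - matrix_apply a f x"]
      b cutoff_mult_diff_le[of k x "matrix_apply a f"] by simp
qed

lemma maximal_subset_op_closure:
  assumes C: "\<And>x y. cmod (a x y) \<le> C * (1 + \<bar>real_of_int x\<bar>)"
  shows "maximal_operator a \<subseteq> op_closure (matrix_operator a)"
proof clarify
  fix f g assume "(f, g) \<in> maximal_operator a"
  then have f: "f \<in> ell2" "matrix_apply a f \<in> ell2" and g: "g = matrix_apply a f"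
    by (auto simp: maximal_operator_def)
  obtain D where "D \<in> ell2"
    "\<And>k x. cmod (matrix_apply a (\<lambda>y. of_real (cutoff k y) * f y) x - matrix_apply a f x) \<le> cmod (D x)"
    using cutoff_matrix_apply_dominated[OF C f] by metis
  then have "ell2_tendsto (\<lambda>k. matrix_apply a (\<lambda>y. of_real (cutoff k y) * f y)) g"
    unfolding g by (rule ell2_tendsto_dominated) (intro matrix_apply_tendsto cutoff_mult_tendsto)
  moreover have "ell2_tendsto (\<lambda>k y. of_real (cutoff k y) * f y) f"
    by (rule cutoff_mult_ell2_tendsto[OF f(1)])
  moreover have "((\<lambda>y. of_real (cutoff k y) * f y), matrix_apply a (\<lambda>y. of_real (cutoff k y) * f y)) \<in> matrix_operator a" for k
    using cutoff_mult_c0[of k f] by (auto simp: matrix_operator_eq)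
  ultimately show "(f, g) \<in> op_closure (matrix_operator a)"
    unfolding op_closure_def g mem_Collect_eq case_prod_conv using f
    by (intro conjI exI[where x = "\<lambda>k y. of_real (cutoff k y) * f y"]
        exI[where x = "\<lambda>k. matrix_apply a (\<lambda>y. of_real (cutoff k y) * f y)"]) auto
qed

section \<open>Self-adjointness of the maximal operator\<close>

text \<open>Only \<open>f\<close> is truncated: \<open>ell2_inner_c0\<close> applies to \<chi>f and
  \<open>g\<close>, and both sides converge by domination.\<close>

lemma maximal_operator_symmetric:
  assumes C: "\<And>x y. cmod (a x y) \<le> C * (1 + \<bar>real_of_int x\<bar>)"
    and f: "f \<in> ell2" "matrix_apply a f \<in> ell2"
    and g: "g \<in> ell2" "matrix_apply a g \<in> ell2"
  shows "ell2_inner (matrix_apply a f) g = ell2_inner f (matrix_apply a g)"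
proof (rule LIMSEQ_unique)
  let ?u = "\<lambda>k y. of_real (cutoff k y) * f y"
  obtain D where "D \<in> ell2" "\<And>k x. cmod (matrix_apply a (?u k) x) \<le> cmod (D x)"
    using cutoff_matrix_apply_dominated[OF C f] by metis
  then show "(\<lambda>k. ell2_inner (matrix_apply a (?u k)) g) \<longlonglongrightarrow> ell2_inner (matrix_apply a f) g"
    by (intro ell2_inner_dominated[OF _ g(1)]) (auto intro: matrix_apply_tendsto cutoff_mult_tendsto)
  show "(\<lambda>k. ell2_inner (matrix_apply a (?u k)) g) \<longlonglongrightarrow> ell2_inner f (matrix_apply a g)"
    unfolding ell2_inner_c0[OF cutoff_mult_c0]
    by (rule ell2_inner_dominated[where D = f]) (fact f(1) g(2) cutoff_mult_le cutoff_mult_tendsto)+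
qed

lemma self_adjoint_maximal_operator:
  assumes C: "\<And>x y. cmod (a x y) \<le> C * (1 + \<bar>real_of_int x\<bar>)"
  shows "self_adjoint_operator (maximal_operator a)"
  unfolding self_adjoint_operator_def
proof (intro conjI linear_maximal_operator densely_defined_if_c0)
  show "c0 \<subseteq> Domain (maximal_operator a)"
    using matrix_operator_subset_maximal by (auto simp: matrix_operator_eq)
  show "op_adjoint (maximal_operator a) = maximal_operator a"
  proof
    \<comment> \<open>Taking adjoints reverses inclusions.\<close>
    have "op_adjoint (maximal_operator a) \<subseteq> op_adjoint (matrix_operator a)"
      using matrix_operator_subset_maximal by (auto simp: op_adjoint_def)
    then show "op_adjoint (maximal_operator a) \<subseteq> maximal_operator a"
      by (simp add: op_adjoint_matrix_operator)
    show "maximal_operator a \<subseteq> op_adjoint (maximal_operator a)"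
      by (auto simp: op_adjoint_def maximal_operator_def intro: maximal_operator_symmetric[OF C])
  qed
qed

lemma essentially_self_adjoint_if_linear_growth:
  assumes C: "\<And>x y. cmod (a x y) \<le> C * (1 + \<bar>real_of_int x\<bar>)"
  shows "essentially_self_adjoint (matrix_operator a)"
proof -
  have "op_closure (matrix_operator a) = maximal_operator a"
    using op_closure_subset_maximal maximal_subset_op_closure[OF C] by blast
  then show ?thesis
    using symmetric_matrix_operator self_adjoint_maximal_operator[OF C]
    by (simp add: essentially_self_adjoint_def)
qed

section \<open>From the limit condition to linear growth\<close>

text \<open>Each entry is at most its absolute row sum. The limit bounds the row sums far out, and
  the finitely many remaining rows are absorbed into the constant.\<close>

lemma linear_growth_if_tendsto:
  assumes "((\<lambda>x::int. (1 / japanese_bracket (of_int x)) * (\<Sum>\<^sub>\<infinity>y. cmod (a x y))) \<longlongrightarrow> 0)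
    (filtercomap abs at_top)"
  obtains C where "\<And>x y. cmod (a x y) \<le> C * (1 + \<bar>real_of_int x\<bar>)"
proof -
  define r where "r x = (\<Sum>\<^sub>\<infinity>y. cmod (a x y))" for x
  have r_eq: "r x = (\<Sum>y\<in>{x - int n..x + int n}. cmod (a x y))" for x
    unfolding r_def by (rule infsum_row) simp
  have r0: "r x \<ge> 0" for x unfolding r_eq by (intro sum_nonneg) auto
  have ar: "cmod (a x y) \<le> r x" for x y
  proof (cases "y \<in> {x - int n..x + int n}")
    case True
    then show ?thesis unfolding r_eq by (intro member_le_sum) auto
  qed (simp add: entry_eq_0 r0)
  have "eventually (\<lambda>x. (1 / japanese_bracket (of_int x)) * r x < 1) (filtercomap abs at_top)"
    using order_tendstoD(2)[OF assms, of 1] by (simp add: r_def)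
  then obtain N :: int where N: "\<And>x. \<bar>x\<bar> \<ge> N \<Longrightarrow> (1 / japanese_bracket (of_int x)) * r x < 1"
    unfolding eventually_filtercomap_at_top_linorder by blast
  \<comment> \<open>The 1 serves the rows with \<bar>x\<bar> \<ge> N, the sum those with
    \<bar>x\<bar> < N.\<close>
  define C where "C = 1 + (\<Sum>x\<in>{-N..N}. r x)"
  have C1: "C \<ge> 1" unfolding C_def using r0 by (simp add: sum_nonneg)
  have "cmod (a x y) \<le> C * (1 + \<bar>real_of_int x\<bar>)" for x y
  proof (cases "\<bar>x\<bar> \<ge> N")
    case True
    have pos: "japanese_bracket (of_int x) > 0"
      unfolding japanese_bracket_def by (simp add: add_pos_nonneg)
    have "r x \<le> japanese_bracket (of_int x)"
      using N[OF True] pos by (simp add: field_simps)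
    also have "\<dots> \<le> 1 + \<bar>real_of_int x\<bar>"
      unfolding japanese_bracket_def
      by (intro real_le_lsqrt) (auto simp: power2_eq_square algebra_simps)
    also have "\<dots> \<le> C * (1 + \<bar>real_of_int x\<bar>)"
      using mult_right_mono[OF C1, of "1 + \<bar>real_of_int x\<bar>"] by simp
    finally show ?thesis using ar[of x y] by linarith
  next
    case False
    then have "r x \<le> (\<Sum>x\<in>{-N..N}. r x)"
      by (intro member_le_sum) (auto intro: r0)
    also have "\<dots> \<le> C" by (simp add: C_def)
    also have "\<dots> \<le> C * (1 + \<bar>real_of_int x\<bar>)"
      using C1 by (simp add: algebra_simps)
    finally show ?thesis using ar[of x y] by linarith
  qed
  then show ?thesis by (rule that)
qed

end

theorem corollary2p2:
  fixes a :: "int \<Rightarrow> int \<Rightarrow> complex" and n :: nat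
  assumes "hermitian_matrix a"
    and "n \<ge> 1"
    and "nJ_matrix n a"
    and "((\<lambda>x::int. (1 / japanese_bracket (of_int x)) * (\<Sum>\<^sub>\<infinity>y. cmod (a x y))) \<longlongrightarrow> 0)
           (filtercomap abs at_top)"
  shows "essentially_self_adjoint (matrix_operator a)"
proof -
  obtain C where "\<And>x y. cmod (a x y) \<le> C * (1 + \<bar>real_of_int x\<bar>)"
    using linear_growth_if_tendsto[OF assms(1,3,4)] by blast
  then show ?thesis by (rule essentially_self_adjoint_if_linear_growth[OF assms(1,3)])
qed

end
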